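(* Let $M$ be a $\vee e$-$\Gamma$-semigroup, let $m,n\in\mathbb{N}=\{1,2,3,\dots\}$ and let $\beta,\gamma\in\Gamma$. The following are equivalent: (1) $M$ is $(m,n,\beta,\gamma)$-regular, i.e. $a\le a_\beta^m\beta e\gamma a_\gamma^n$ for every $a\in M$. (2) $a_\beta^m\beta e\gamma a_\gamma^n=a$ for every $(m,n,\beta,\gamma)$-ideal element $a$ of $M$.
   Context: A $\Gamma$-semigroup consists of nonempty sets $M$ and $\Gamma$ together with a map $M\times\Gamma\times M\to M$, $(a,\gamma,b)\mapsto a\gamma b$, such that $(a\gamma b)\mu c=a\gamma(b\mu c)$ for all $a,b,c\in M$, $\gamma,\mu\in\Gamma$. A $\vee e$-$\Gamma$-semigroup is a $\Gamma$-semigroup $M$ that is also a join-semilattice (partial order $\le$ with binary supremum $\vee$) with a greatest element $e$, such that $a\gamma(b\vee c)=a\gamma b\vee a\gamma c$ and $(a\vee b)\gamma c=a\gamma c\vee b\gamma c$ for all $a,b,c\in M$, $\gamma\in\Gamma$. Powers: for $a\in M$, $\gamma\in\Gamma$, put $a_\gamma^1:=a$ and, for $m\ge 2$, $a_\gamma^m:=a\gamma a\gamma\cdots\gamma a$ ($m$ copies of $a$ and $m-1$ copies of $\gamma$). An element $a\in M$ is an $(m,n,\beta,\gamma)$-ideal element if $a_\beta^m\beta e\gamma a_\gamma^n\le a$. *)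

theory Defs
  imports Main
begin

(* M and Gamma are the types 'm and 'g (hence nonempty); gm a \<gamma> b is the product a\<gamma>b. *)
locale gamma_semigroup =
  fixes gm :: "'m \<Rightarrow> 'g \<Rightarrow> 'm \<Rightarrow> 'm"
  assumes gm_assoc: "gm (gm a \<gamma> b) \<mu> c = gm a \<gamma> (gm b \<mu> c)"

(* The greatest element e is the constant top of class order_top. *)
locale vee_e_gamma_semigroup = gamma_semigroup gm
  for gm :: "'m::{semilattice_sup, order_top} \<Rightarrow> 'g \<Rightarrow> 'm \<Rightarrow> 'm" +
  assumes gm_sup_right: "gm a \<gamma> (sup b c) = sup (gm a \<gamma> b) (gm a \<gamma> c)"
    and gm_sup_left: "gm (sup a b) \<gamma> c = sup (gm a \<gamma> c) (gm b \<gamma> c)"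

(* gpow gm a \<gamma> m is a\<gamma>a\<gamma>...\<gamma>a with m copies of a, for m \<ge> 1. There is no zeroth power;
   the value at 0 is a dummy. *)
fun gpow :: "('m \<Rightarrow> 'g \<Rightarrow> 'm \<Rightarrow> 'm) \<Rightarrow> 'm \<Rightarrow> 'g \<Rightarrow> nat \<Rightarrow> 'm" where
  "gpow gm a \<gamma> 0 = a"
| "gpow gm a \<gamma> (Suc 0) = a"
| "gpow gm a \<gamma> (Suc (Suc m)) = gm (gpow gm a \<gamma> (Suc m)) \<gamma> a"

definition mn_ideal_element ::
  "('m::{semilattice_sup, order_top} \<Rightarrow> 'g \<Rightarrow> 'm \<Rightarrow> 'm) \<Rightarrow> nat \<Rightarrow> nat \<Rightarrow> 'g \<Rightarrow> 'g \<Rightarrow> 'm \<Rightarrow> bool" where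
  "mn_ideal_element gm m n \<beta> \<gamma> a \<longleftrightarrow>
     gm (gm (gpow gm a \<beta> m) \<beta> top) \<gamma> (gpow gm a \<gamma> n) \<le> a"

definition mn_regular ::
  "('m::{semilattice_sup, order_top} \<Rightarrow> 'g \<Rightarrow> 'm \<Rightarrow> 'm) \<Rightarrow> nat \<Rightarrow> nat \<Rightarrow> 'g \<Rightarrow> 'g \<Rightarrow> bool" where
  "mn_regular gm m n \<beta> \<gamma> \<longleftrightarrow>
     (\<forall>a. a \<le> gm (gm (gpow gm a \<beta> m) \<beta> top) \<gamma> (gpow gm a \<gamma> n))"

end

theory Submission
  imports Defs
begin

text \<open>
  Write \<open>Q a\<close> for \<open>a\<^sup>m \<beta> e \<gamma> a\<^sup>n\<close>. For the nontrivial direction, take any \<open>a\<close> and put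
  \<open>b = a \<squnion> Q a\<close>. Expanding \<open>b\<^sup>m \<beta> e\<close> by distributivity, every word containing \<open>Q a\<close>
  begins with at least \<open>m\<close> copies of \<open>a\<close>, hence \<open>b\<^sup>m \<beta> e \<le> a\<^sup>m \<beta> e\<close>; dually
  \<open>e \<gamma> b\<^sup>n \<le> e \<gamma> a\<^sup>n\<close>. Therefore \<open>Q b \<le> Q a \<le> b\<close>, so \<open>b\<close> is an ideal element,
  and the hypothesis gives \<open>a \<le> b = Q b \<le> Q a\<close>.
\<close>

context gamma_semigroup
begin

lemma gpow_Suc_right: "k \<ge> 1 \<Longrightarrow> gpow gm a \<gamma> (Suc k) = gm (gpow gm a \<gamma> k) \<gamma> a"
  by (cases k) auto

lemma gpow_Suc_left: "k \<ge> 1 \<Longrightarrow> gpow gm a \<gamma> (Suc k) = gm a \<gamma> (gpow gm a \<gamma> k)"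
  by (induction k rule: dec_induct) (auto simp: gpow_Suc_right gm_assoc)

end

context vee_e_gamma_semigroup
begin

lemma gm_mono_right: "b \<le> c \<Longrightarrow> gm a \<gamma> b \<le> gm a \<gamma> c"
  by (metis gm_sup_right le_iff_sup)

lemma gm_mono_left: "a \<le> b \<Longrightarrow> gm a \<gamma> c \<le> gm b \<gamma> c"
  by (metis gm_sup_left le_iff_sup)

text \<open>Surplus copies of \<open>a\<close> next to \<open>top\<close> are absorbed, because
  \<open>gm a \<gamma> top \<le> top\<close>.\<close>

lemma gpow_top_antimono:
  assumes "1 \<le> j" "j \<le> k"
  shows "gm (gpow gm a \<gamma> k) \<gamma> top \<le> gm (gpow gm a \<gamma> j) \<gamma> top"
  using assms(2)
proof (induction k rule: dec_induct)
  case (step k)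
  have "gm (gpow gm a \<gamma> (Suc k)) \<gamma> top \<le> gm (gpow gm a \<gamma> k) \<gamma> top"
    using step assms(1) by (simp add: gpow_Suc_right gm_assoc gm_mono_right)
  with step.IH show ?case by order
qed simp

lemma top_gpow_antimono:
  assumes "1 \<le> j" "j \<le> k"
  shows "gm top \<gamma> (gpow gm a \<gamma> k) \<le> gm top \<gamma> (gpow gm a \<gamma> j)"
  using assms(2)
proof (induction k rule: dec_induct)
  case (step k)
  have "gm top \<gamma> (gpow gm a \<gamma> (Suc k)) \<le> gm top \<gamma> (gpow gm a \<gamma> k)"
    using step assms(1) by (simp add: gpow_Suc_left gm_assoc[symmetric] gm_mono_left)
  with step.IH show ?case by order
qed simp

text \<open>The assumption on \<open>q\<close> abstracts the only property of \<open>Q a\<close>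
  used on this side: it starts with \<open>m\<close> copies of \<open>a\<close>, whatever follows.
  The induction peels off the first factor \<open>sup a q\<close>, so that the rest, still ending in
  \<open>top\<close>, falls under the induction hypothesis.\<close>

lemma gpow_sup_top_le:
  assumes q: "\<And>y. gm q \<gamma> y \<le> gm (gpow gm a \<gamma> m) \<gamma> top" and k: "1 \<le> k" "k \<le> m"
  shows "gm (gpow gm (sup a q) \<gamma> k) \<gamma> top \<le> gm (gpow gm a \<gamma> k) \<gamma> top"
  using k
proof (induction k rule: dec_induct)
  case base
  then show ?case
    using order_trans[OF q gpow_top_antimono[of 1 m]] by (simp add: gm_sup_left)
next
  case (step k)
  have "gm (gpow gm (sup a q) \<gamma> (Suc k)) \<gamma> top
      = gm (sup a q) \<gamma> (gm (gpow gm (sup a q) \<gamma> k) \<gamma> top)"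
    using step by (simp add: gpow_Suc_left gm_assoc)
  also have "\<dots> \<le> gm (sup a q) \<gamma> (gm (gpow gm a \<gamma> k) \<gamma> top)"
    using step by (simp add: gm_mono_right)
  also have "\<dots> = sup (gm (gpow gm a \<gamma> (Suc k)) \<gamma> top) (gm q \<gamma> (gm (gpow gm a \<gamma> k) \<gamma> top))"
    using step by (simp add: gm_sup_left gpow_Suc_left gm_assoc)
  \<comment> \<open>The summand starting with \<open>q\<close> lies below
    \<open>gm (gpow gm a \<gamma> m) \<gamma> top\<close>; as \<open>Suc k \<le> m\<close>, the
    extra copies of \<open>a\<close> are absorbed.\<close>
  also have "\<dots> \<le> gm (gpow gm a \<gamma> (Suc k)) \<gamma> top"
    using order_trans[OF q gpow_top_antimono[of "Suc k" m]] step by simp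
  finally show ?case .
qed

text \<open>Mirror image: \<open>q\<close> now ends in \<open>n\<close> copies of \<open>a\<close>,
  and the last factor is peeled off.\<close>

lemma top_gpow_sup_le:
  assumes q: "\<And>y. gm y \<gamma> q \<le> gm top \<gamma> (gpow gm a \<gamma> n)" and k: "1 \<le> k" "k \<le> n"
  shows "gm top \<gamma> (gpow gm (sup a q) \<gamma> k) \<le> gm top \<gamma> (gpow gm a \<gamma> k)"
  using k
proof (induction k rule: dec_induct)
  case base
  then show ?case
    using order_trans[OF q top_gpow_antimono[of 1 n]] by (simp add: gm_sup_right)
next
  case (step k)
  have "gm top \<gamma> (gpow gm (sup a q) \<gamma> (Suc k))
      = gm (gm top \<gamma> (gpow gm (sup a q) \<gamma> k)) \<gamma> (sup a q)"
    using step by (simp add: gpow_Suc_right gm_assoc)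
  also have "\<dots> \<le> gm (gm top \<gamma> (gpow gm a \<gamma> k)) \<gamma> (sup a q)"
    using step by (simp add: gm_mono_left)
  also have "\<dots> = sup (gm top \<gamma> (gpow gm a \<gamma> (Suc k))) (gm (gm top \<gamma> (gpow gm a \<gamma> k)) \<gamma> q)"
    using step by (simp add: gm_sup_right gpow_Suc_right gm_assoc)
  also have "\<dots> \<le> gm top \<gamma> (gpow gm a \<gamma> (Suc k))"
    using order_trans[OF q top_gpow_antimono[of "Suc k" n]] step by simp
  finally show ?case .
qed

lemma sandwich_sup_le:
  fixes a :: 'm and \<beta> \<gamma> :: 'g
  assumes "m \<ge> 1" "n \<ge> 1"
  defines "Q \<equiv> \<lambda>x. gm (gm (gpow gm x \<beta> m) \<beta> top) \<gamma> (gpow gm x \<gamma> n)"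
  shows "Q (sup a (Q a)) \<le> Q a"
proof -
  let ?b = "sup a (Q a)"
  \<comment> \<open>In \<open>gm (Q a) \<beta> y\<close>, everything after the prefix
    \<open>gpow gm a \<beta> m\<close> and its \<open>\<beta>\<close> is one element below
    \<open>top\<close>, which is the assumption on \<open>q\<close>.\<close>
  have left: "gm (gpow gm ?b \<beta> m) \<beta> top \<le> gm (gpow gm a \<beta> m) \<beta> top"
    using assms(1) by (intro gpow_sup_top_le) (auto simp: Q_def gm_assoc gm_mono_right)
  have right: "gm top \<gamma> (gpow gm ?b \<gamma> n) \<le> gm top \<gamma> (gpow gm a \<gamma> n)"
    using assms(2)
    by (intro top_gpow_sup_le) (auto simp: Q_def gm_assoc[symmetric] gm_mono_left)
  \<comment> \<open>Both bounds need the single \<open>top\<close> in the middle, so they are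
    applied in turn: it is grouped with the right power first, then with the left one.\<close>
  have "Q ?b \<le> gm (gpow gm ?b \<beta> m) \<beta> (gm top \<gamma> (gpow gm a \<gamma> n))"
    unfolding Q_def gm_assoc using gm_mono_right[OF right] by (simp add: Q_def gm_assoc)
  also have "\<dots> \<le> Q a"
    using gm_mono_left[OF left] by (simp add: Q_def gm_assoc[symmetric])
  finally show ?thesis .
qed

end

theorem theorem8:
  fixes gm :: "'m::{semilattice_sup, order_top} \<Rightarrow> 'g \<Rightarrow> 'm \<Rightarrow> 'm"
    and m n :: nat and \<beta> \<gamma> :: 'g
  assumes "vee_e_gamma_semigroup gm" and "m \<ge> 1" and "n \<ge> 1"
  shows "mn_regular gm m n \<beta> \<gamma> \<longleftrightarrow>
    (\<forall>a. mn_ideal_element gm m n \<beta> \<gamma> a \<longrightarrow>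
       gm (gm (gpow gm a \<beta> m) \<beta> top) \<gamma> (gpow gm a \<gamma> n) = a)"
proof
  assume "mn_regular gm m n \<beta> \<gamma>"
  then show "\<forall>a. mn_ideal_element gm m n \<beta> \<gamma> a \<longrightarrow>
      gm (gm (gpow gm a \<beta> m) \<beta> top) \<gamma> (gpow gm a \<gamma> n) = a"
    by (simp add: mn_regular_def mn_ideal_element_def order_antisym)
next
  interpret vee_e_gamma_semigroup gm by fact
  define Q where "Q x = gm (gm (gpow gm x \<beta> m) \<beta> top) \<gamma> (gpow gm x \<gamma> n)" for x
  assume "\<forall>a. mn_ideal_element gm m n \<beta> \<gamma> a \<longrightarrow>
      gm (gm (gpow gm a \<beta> m) \<beta> top) \<gamma> (gpow gm a \<gamma> n) = a"
  then have fixed: "Q x = x" if "Q x \<le> x" for x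
    using that by (simp add: Q_def mn_ideal_element_def)
  have "a \<le> Q a" for a
  proof -
    have le: "Q (sup a (Q a)) \<le> Q a"
      using sandwich_sup_le assms(2,3) by (simp add: Q_def)
    then have "Q (sup a (Q a)) = sup a (Q a)"
      by (intro fixed) (simp add: le_supI2)
    with le show ?thesis by simp
  qed
  then show "mn_regular gm m n \<beta> \<gamma>"
    by (simp add: mn_regular_def Q_def)
qed

end
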